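(* In the monadic metalanguage described in the context (extended with streams and with a constant $\mathtt{iid}$ satisfying its recursive equation), let $\mathtt{p} :: \mathtt{Prob}\ \mathtt{RealNum}$ be a term, and let $i_1,\dots,i_n$ be a finite sequence of pairwise distinct natural-number indices. Then the following two programs of type $\mathtt{Prob}\,(\mathtt{RealNum},\dots,\mathtt{RealNum})$ ($n$ components) are equal in the equational theory: (1) $\mathtt{do}\,\{xs \leftarrow \mathtt{iid}\ \mathtt{p};\ \mathtt{return}\ (xs\,!!\,i_1,\ \dots,\ xs\,!!\,i_n)\}$; (2) $\mathtt{do}\,\{x_1 \leftarrow \mathtt{p};\ \dots;\ x_n \leftarrow \mathtt{p};\ \mathtt{return}\ (x_1,\dots,x_n)\}$, where the bound variables $xs,x_1,\dots,x_n$ are distinct and not free in $\mathtt{p}$.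
   Context: Metalanguage. Types: $a,b ::= \mathtt{RealNum} \mid () \mid (a,b) \mid a\to b \mid \mathtt{Prob}\ a \mid \mathtt{Meas}\ a \mid \mathtt{Stream}\ a$. Terms: variables $x$, abstractions $\lambda x.\,t$, applications $t\,u$, $\mathtt{return}\ t$, and $\mathtt{do}\{x\leftarrow t;\,u\}$, together with typed constants. Typing is that of simply typed $\lambda$-calculus, plus, for each $m\in\{\mathtt{Prob},\mathtt{Meas}\}$: if $\Gamma\vdash t::a$ then $\Gamma\vdash \mathtt{return}\ t :: m\,a$; if $\Gamma\vdash t :: m\,a$ and $\Gamma,x::a\vdash u :: m\,b$ then $\Gamma\vdash \mathtt{do}\{x\leftarrow t;u\} :: m\,b$. Nested do-blocks are abbreviated $\mathtt{do}\{x\leftarrow t;\,y\leftarrow u;\dots\}$. Constants: $()::()$; pairing $(\_,\_) :: a\to b\to (a,b)$; $\mathtt{fst}::(a,b)\to a$; $\mathtt{snd}::(a,b)\to b$; $0,1::\mathtt{RealNum}$; multiplication $*$ on $\mathtt{RealNum}$; $\mathtt{sample}::\mathtt{Prob}\ a\to\mathtt{Meas}\ a$; $\mathtt{score}::\mathtt{RealNum}\to\mathtt{Meas}\,()$; and for streams $\mathtt{hd}::\mathtt{Stream}\ a\to a$, $\mathtt{tl}::\mathtt{Stream}\ a\to\mathtt{Stream}\ a$, $(:)::a\to\mathtt{Stream}\ a\to\mathtt{Stream}\ a$; and $\mathtt{iid}::\mathtt{Prob}\ \mathtt{RealNum}\to\mathtt{Prob}\,(\mathtt{Stream}\ \mathtt{RealNum})$.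 Tuples are iterated pairs. $xs\,!!\,i$ is the $i$-th element (counting from $0$), i.e. $\mathtt{hd}$ applied to the $i$-fold application of $\mathtt{tl}$ to $xs$. Equational theory. Equality is a typed congruence (closed under substitution, and up to renaming of bound variables) satisfying: - if $\Gamma\vdash t::()$ then $t=()$; $\mathtt{fst}(t,u)=t$; $\mathtt{snd}(t,u)=u$; $t=(\mathtt{fst}\,t,\mathtt{snd}\,t)$; $(\lambda x.t)\,u=t[u/x]$; $u=\lambda x.(u\,x)$ ($x$ not free in $u$); - monad laws for $\mathtt{Prob}$ and $\mathtt{Meas}$: $\mathtt{do}\{y\leftarrow\mathtt{do}\{x\leftarrow s;t\};u\}=\mathtt{do}\{x\leftarrow s;\mathtt{do}\{y\leftarrow t;u\}\}$ ($x$ not free in $u$); $\mathtt{do}\{x\leftarrow\mathtt{return}\ t;u\}=u[t/x]$; $\mathtt{do}\{x\leftarrow t;\mathtt{return}\ x\}=t$; - $\mathtt{sample}$ is a monad morphism: $\mathtt{sample}(\mathtt{return}\ t)=\mathtt{return}\ t$ and $\mathtt{sample}(\mathtt{do}\{x\leftarrow p;q\})=\mathtt{do}\{x\leftarrow\mathtt{sample}\ p;\mathtt{sample}\ q\}$; - commutativity, for both $\mathtt{Meas}$ and $\mathtt{Prob}$: $\mathtt{do}\{x\leftarrow mx;y\leftarrow my;\mathtt{return}(x,y)\}=\mathtt{do}\{y\leftarrow my;x\leftarrow mx;\mathtt{return}(x,y)\}$ when $x$ is not free in $my$ and $y$ is not free in $mx$; - affinity of $\mathtt{Prob}$ only: $\mathtt{do}\{x\leftarrow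 mx;\mathtt{return}\,()\}=\mathtt{return}\,()$ for $mx::\mathtt{Prob}\ a$; - scores: $\mathtt{score}\ 1=\mathtt{return}\,()$; $\mathtt{do}\{\mathtt{score}\ r;\mathtt{score}\ s\}=\mathtt{score}(r*s)$; $\mathtt{do}\{\mathtt{score}\ 0;mx\}=\mathtt{do}\{\mathtt{score}\ 0;my\}$ for $mx,my::\mathtt{Meas}\ a$; - streams: $\mathtt{hd}(x:xs)=x$; $\mathtt{tl}(x:xs)=xs$; $(\mathtt{hd}\ xs):(\mathtt{tl}\ xs)=xs$; - $\mathtt{iid}$: $\mathtt{iid}\ p=\mathtt{do}\{x\leftarrow p;\ xs\leftarrow\mathtt{iid}\ p;\ \mathtt{return}(x:xs)\}$. *)

theory Defs
  imports Main
begin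

datatype ty =
    RealNum
  | UnitT
  | ProdT ty ty
  | FunT ty ty
  | Prob ty
  | Meas ty
  | Stream ty

text \<open>
  Each constant stands for all its typed instances; which ones is given by \<open>const_type\<close> below.
\<close>

datatype const =
    CUnit | CPair | CFst | CSnd | CZero | COne | CMult | CSample | CScore
  | CHd | CTl | CCons | CIid

text \<open>
  Terms are taken up to renaming of bound variables by using de Bruijn indices: \<open>Lam t\<close> binds
  index 0 in \<open>t\<close>, and \<open>Bind t u\<close>, which stands for \<open>do {x \<leftarrow> t; u}\<close>, binds index 0 in \<open>u\<close> only.
\<close>

datatype tm =
    Var nat
  | Const const
  | Lam tm
  | App tm tm
  | Return tm
  | Bind tm tm

definition up_ren :: "(nat \<Rightarrow> nat) \<Rightarrow> nat \<Rightarrow> nat" where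
  "up_ren r i = (case i of 0 \<Rightarrow> 0 | Suc j \<Rightarrow> Suc (r j))"

primrec rename :: "(nat \<Rightarrow> nat) \<Rightarrow> tm \<Rightarrow> tm" where
  "rename r (Var i) = Var (r i)"
| "rename r (Const c) = Const c"
| "rename r (Lam t) = Lam (rename (up_ren r) t)"
| "rename r (App t u) = App (rename r t) (rename r u)"
| "rename r (Return t) = Return (rename r t)"
| "rename r (Bind t u) = Bind (rename r t) (rename (up_ren r) u)"

text \<open>
  \<open>lift t\<close> is \<open>t\<close> placed under one more binder whose variable is not free in \<open>t\<close>;
  all freshness side conditions are expressed by \<open>lift\<close>.
\<close>

definition lift :: "tm \<Rightarrow> tm" where
  "lift = rename Suc"

definition up :: "(nat \<Rightarrow> tm) \<Rightarrow> nat \<Rightarrow> tm" where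
  "up s i = (case i of 0 \<Rightarrow> Var 0 | Suc j \<Rightarrow> lift (s j))"

primrec subst :: "(nat \<Rightarrow> tm) \<Rightarrow> tm \<Rightarrow> tm" where
  "subst s (Var i) = s i"
| "subst s (Const c) = Const c"
| "subst s (Lam t) = Lam (subst (up s) t)"
| "subst s (App t u) = App (subst s t) (subst s u)"
| "subst s (Return t) = Return (subst s t)"
| "subst s (Bind t u) = Bind (subst s t) (subst (up s) u)"

text \<open>\<open>subst0 u t\<close> is \<open>t[u/x]\<close> for \<open>x\<close> the variable with index 0; the other indices drop by one.\<close>

definition subst0 :: "tm \<Rightarrow> tm \<Rightarrow> tm" where
  "subst0 u = subst (case_nat u Var)"

abbreviation "unit_tm \<equiv> Const CUnit"
abbreviation "pair_tm t u \<equiv> App (App (Const CPair) t) u"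
abbreviation "fst_tm t \<equiv> App (Const CFst) t"
abbreviation "snd_tm t \<equiv> App (Const CSnd) t"
abbreviation "zero_tm \<equiv> Const CZero"
abbreviation "one_tm \<equiv> Const COne"
abbreviation "mult_tm t u \<equiv> App (App (Const CMult) t) u"
abbreviation "sample t \<equiv> App (Const CSample) t"
abbreviation "score t \<equiv> App (Const CScore) t"
abbreviation "hd_tm t \<equiv> App (Const CHd) t"
abbreviation "tl_tm t \<equiv> App (Const CTl) t"
abbreviation "cons_tm t u \<equiv> App (App (Const CCons) t) u"
abbreviation "iid t \<equiv> App (Const CIid) t"

inductive const_type :: "const \<Rightarrow> ty \<Rightarrow> bool" where
  "const_type CUnit UnitT"
| "const_type CPair (FunT a (FunT b (ProdT a b)))"
| "const_type CFst (FunT (ProdT a b) a)"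
| "const_type CSnd (FunT (ProdT a b) b)"
| "const_type CZero RealNum"
| "const_type COne RealNum"
| "const_type CMult (FunT RealNum (FunT RealNum RealNum))"
| "const_type CSample (FunT (Prob a) (Meas a))"
| "const_type CScore (FunT RealNum (Meas UnitT))"
| "const_type CHd (FunT (Stream a) a)"
| "const_type CTl (FunT (Stream a) (Stream a))"
| "const_type CCons (FunT a (FunT (Stream a) (Stream a)))"
| "const_type CIid (FunT (Prob RealNum) (Prob (Stream RealNum)))"

text \<open>A context lists the types of the variables, the most recently bound one (index 0) first.\<close>

inductive typing :: "ty list \<Rightarrow> tm \<Rightarrow> ty \<Rightarrow> bool" ("_ \<turnstile> _ \<Colon> _" [50, 50, 50] 50) where
  T_Var: "i < length \<Gamma> \<Longrightarrow> \<Gamma> \<turnstile> Var i \<Colon> \<Gamma> ! i"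
| T_Const: "const_type c a \<Longrightarrow> \<Gamma> \<turnstile> Const c \<Colon> a"
| T_Lam: "a # \<Gamma> \<turnstile> t \<Colon> b \<Longrightarrow> \<Gamma> \<turnstile> Lam t \<Colon> FunT a b"
| T_App: "\<Gamma> \<turnstile> t \<Colon> FunT a b \<Longrightarrow> \<Gamma> \<turnstile> u \<Colon> a \<Longrightarrow> \<Gamma> \<turnstile> App t u \<Colon> b"
| T_Return: "m \<in> {Prob, Meas} \<Longrightarrow> \<Gamma> \<turnstile> t \<Colon> a \<Longrightarrow> \<Gamma> \<turnstile> Return t \<Colon> m a"
| T_Bind: "m \<in> {Prob, Meas} \<Longrightarrow> \<Gamma> \<turnstile> t \<Colon> m a \<Longrightarrow> a # \<Gamma> \<turnstile> u \<Colon> m b \<Longrightarrow> \<Gamma> \<turnstile> Bind t u \<Colon> m b"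

text \<open>
  The equational theory: \<open>\<Gamma> \<turnstile> t \<doteq> u \<Colon> a\<close> says that \<open>t\<close> and \<open>u\<close> are provably equal at type \<open>a\<close> in
  context \<open>\<Gamma>\<close>. The axioms carry typing premises, so that only well-typed terms are related.
\<close>

inductive equal :: "ty list \<Rightarrow> tm \<Rightarrow> tm \<Rightarrow> ty \<Rightarrow> bool"
    ("_ \<turnstile> _ \<doteq> _ \<Colon> _" [50, 50, 50, 50] 50) where
  E_refl: "\<Gamma> \<turnstile> t \<Colon> a \<Longrightarrow> \<Gamma> \<turnstile> t \<doteq> t \<Colon> a"
| E_sym: "\<Gamma> \<turnstile> t \<doteq> u \<Colon> a \<Longrightarrow> \<Gamma> \<turnstile> u \<doteq> t \<Colon> a"
| E_trans: "\<Gamma> \<turnstile> s \<doteq> t \<Colon> a \<Longrightarrow> \<Gamma> \<turnstile> t \<doteq> u \<Colon> a \<Longrightarrow> \<Gamma> \<turnstile> s \<doteq> u \<Colon> a"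
| E_Lam: "a # \<Gamma> \<turnstile> t \<doteq> t' \<Colon> b \<Longrightarrow> \<Gamma> \<turnstile> Lam t \<doteq> Lam t' \<Colon> FunT a b"
| E_App: "\<Gamma> \<turnstile> t \<doteq> t' \<Colon> FunT a b \<Longrightarrow> \<Gamma> \<turnstile> u \<doteq> u' \<Colon> a \<Longrightarrow> \<Gamma> \<turnstile> App t u \<doteq> App t' u' \<Colon> b"
| E_Return: "m \<in> {Prob, Meas} \<Longrightarrow> \<Gamma> \<turnstile> t \<doteq> t' \<Colon> a \<Longrightarrow> \<Gamma> \<turnstile> Return t \<doteq> Return t' \<Colon> m a"
| E_Bind: "m \<in> {Prob, Meas} \<Longrightarrow> \<Gamma> \<turnstile> t \<doteq> t' \<Colon> m a \<Longrightarrow> a # \<Gamma> \<turnstile> u \<doteq> u' \<Colon> m b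
    \<Longrightarrow> \<Gamma> \<turnstile> Bind t u \<doteq> Bind t' u' \<Colon> m b"
| E_subst: "\<Gamma> \<turnstile> t \<doteq> u \<Colon> a \<Longrightarrow> (\<And>i. i < length \<Gamma> \<Longrightarrow> \<Delta> \<turnstile> s i \<Colon> \<Gamma> ! i)
    \<Longrightarrow> \<Delta> \<turnstile> subst s t \<doteq> subst s u \<Colon> a"

| E_unit: "\<Gamma> \<turnstile> t \<Colon> UnitT \<Longrightarrow> \<Gamma> \<turnstile> t \<doteq> unit_tm \<Colon> UnitT"
| E_fst: "\<Gamma> \<turnstile> t \<Colon> a \<Longrightarrow> \<Gamma> \<turnstile> u \<Colon> b \<Longrightarrow> \<Gamma> \<turnstile> fst_tm (pair_tm t u) \<doteq> t \<Colon> a"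
| E_snd: "\<Gamma> \<turnstile> t \<Colon> a \<Longrightarrow> \<Gamma> \<turnstile> u \<Colon> b \<Longrightarrow> \<Gamma> \<turnstile> snd_tm (pair_tm t u) \<doteq> u \<Colon> b"
| E_pair: "\<Gamma> \<turnstile> t \<Colon> ProdT a b \<Longrightarrow> \<Gamma> \<turnstile> t \<doteq> pair_tm (fst_tm t) (snd_tm t) \<Colon> ProdT a b"
| E_beta: "a # \<Gamma> \<turnstile> t \<Colon> b \<Longrightarrow> \<Gamma> \<turnstile> u \<Colon> a \<Longrightarrow> \<Gamma> \<turnstile> App (Lam t) u \<doteq> subst0 u t \<Colon> b"
| E_eta: "\<Gamma> \<turnstile> u \<Colon> FunT a b \<Longrightarrow> \<Gamma> \<turnstile> u \<doteq> Lam (App (lift u) (Var 0)) \<Colon> FunT a b"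

(* rename (up_ren Suc) u: u under the additional outer binder x, which is not free in it *)
| E_assoc: "m \<in> {Prob, Meas} \<Longrightarrow> \<Gamma> \<turnstile> s \<Colon> m a \<Longrightarrow> a # \<Gamma> \<turnstile> t \<Colon> m b \<Longrightarrow> b # \<Gamma> \<turnstile> u \<Colon> m c
    \<Longrightarrow> \<Gamma> \<turnstile> Bind (Bind s t) u \<doteq> Bind s (Bind t (rename (up_ren Suc) u)) \<Colon> m c"
| E_left_unit: "m \<in> {Prob, Meas} \<Longrightarrow> \<Gamma> \<turnstile> t \<Colon> a \<Longrightarrow> a # \<Gamma> \<turnstile> u \<Colon> m b
    \<Longrightarrow> \<Gamma> \<turnstile> Bind (Return t) u \<doteq> subst0 t u \<Colon> m b"
| E_right_unit: "m \<in> {Prob, Meas} \<Longrightarrow> \<Gamma> \<turnstile> t \<Colon> m a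
    \<Longrightarrow> \<Gamma> \<turnstile> Bind t (Return (Var 0)) \<doteq> t \<Colon> m a"

| E_sample_return: "\<Gamma> \<turnstile> t \<Colon> a \<Longrightarrow> \<Gamma> \<turnstile> sample (Return t) \<doteq> Return t \<Colon> Meas a"
| E_sample_bind: "\<Gamma> \<turnstile> p \<Colon> Prob a \<Longrightarrow> a # \<Gamma> \<turnstile> q \<Colon> Prob b
    \<Longrightarrow> \<Gamma> \<turnstile> sample (Bind p q) \<doteq> Bind (sample p) (sample q) \<Colon> Meas b"

| E_commute: "m \<in> {Prob, Meas} \<Longrightarrow> \<Gamma> \<turnstile> mx \<Colon> m a \<Longrightarrow> \<Gamma> \<turnstile> my \<Colon> m b
    \<Longrightarrow> \<Gamma> \<turnstile> Bind mx (Bind (lift my) (Return (pair_tm (Var 1) (Var 0))))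
         \<doteq> Bind my (Bind (lift mx) (Return (pair_tm (Var 0) (Var 1)))) \<Colon> m (ProdT a b)"
| E_affine: "\<Gamma> \<turnstile> mx \<Colon> Prob a \<Longrightarrow> \<Gamma> \<turnstile> Bind mx (Return unit_tm) \<doteq> Return unit_tm \<Colon> Prob UnitT"

| E_score_one: "\<Gamma> \<turnstile> score one_tm \<doteq> Return unit_tm \<Colon> Meas UnitT"
| E_score_mult: "\<Gamma> \<turnstile> r \<Colon> RealNum \<Longrightarrow> \<Gamma> \<turnstile> s \<Colon> RealNum
    \<Longrightarrow> \<Gamma> \<turnstile> Bind (score r) (lift (score s)) \<doteq> score (mult_tm r s) \<Colon> Meas UnitT"
| E_score_zero: "\<Gamma> \<turnstile> mx \<Colon> Meas a \<Longrightarrow> \<Gamma> \<turnstile> my \<Colon> Meas a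
    \<Longrightarrow> \<Gamma> \<turnstile> Bind (score zero_tm) (lift mx) \<doteq> Bind (score zero_tm) (lift my) \<Colon> Meas a"

| E_hd: "\<Gamma> \<turnstile> x \<Colon> a \<Longrightarrow> \<Gamma> \<turnstile> xs \<Colon> Stream a \<Longrightarrow> \<Gamma> \<turnstile> hd_tm (cons_tm x xs) \<doteq> x \<Colon> a"
| E_tl: "\<Gamma> \<turnstile> x \<Colon> a \<Longrightarrow> \<Gamma> \<turnstile> xs \<Colon> Stream a \<Longrightarrow> \<Gamma> \<turnstile> tl_tm (cons_tm x xs) \<doteq> xs \<Colon> Stream a"
| E_cons: "\<Gamma> \<turnstile> xs \<Colon> Stream a \<Longrightarrow> \<Gamma> \<turnstile> cons_tm (hd_tm xs) (tl_tm xs) \<doteq> xs \<Colon> Stream a"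

| E_iid: "\<Gamma> \<turnstile> p \<Colon> Prob RealNum
    \<Longrightarrow> \<Gamma> \<turnstile> iid p \<doteq> Bind p (Bind (lift (iid p)) (Return (cons_tm (Var 1) (Var 0))))
         \<Colon> Prob (Stream RealNum)"

definition nth_tm :: "tm \<Rightarrow> nat \<Rightarrow> tm" where
  "nth_tm xs i = hd_tm ((App (Const CTl) ^^ i) xs)"

text \<open>
  Tuples are pairs nested to the right; the empty tuple is \<open>()\<close>, and a 1-tuple is its component.
\<close>

fun tuple :: "tm list \<Rightarrow> tm" where
  "tuple [] = unit_tm"
| "tuple [t] = t"
| "tuple (t # u # ts) = pair_tm t (tuple (u # ts))"

fun tuple_type :: "ty list \<Rightarrow> ty" where
  "tuple_type [] = UnitT"
| "tuple_type [a] = a"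
| "tuple_type (a # b # as) = ProdT a (tuple_type (b # as))"

text \<open>
  \<open>do_repeat n p u\<close> is \<open>do {x\<^sub>1 \<leftarrow> p; \<dots>; x\<^sub>n \<leftarrow> p; u}\<close>, with no \<open>x\<^sub>k\<close> free in \<open>p\<close>;
  in \<open>u\<close>, the variable \<open>x\<^sub>k\<close> has index \<open>n - k\<close>.
\<close>

primrec do_repeat :: "nat \<Rightarrow> tm \<Rightarrow> tm \<Rightarrow> tm" where
  "do_repeat 0 p u = u"
| "do_repeat (Suc n) p u = Bind p (do_repeat n (lift p) u)"

end

theory Submission
  imports Defs "HOL-Combinatorics.Transposition"
begin

text \<open>
  The programs are compared for an arbitrary continuation \<open>u\<close> with \<open>n\<close> real variables in place of
  the tuple, by induction on a strict bound for the indices. Unfold \<open>iid p\<close> once. If the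
  head of the stream is not read, affinity discards it and all indices drop by one. Otherwise, by
  commutativity, the variable that reads the head may be assumed to be the one bound first;
  the remaining indices drop by one under its binder.
\<close>

section \<open>Renaming and substitution\<close>

lemma up_ren_simps [simp]: "up_ren r 0 = 0" "up_ren r (Suc i) = Suc (r i)"
  by (simp_all add: up_ren_def)

lemma up_simps [simp]: "up s 0 = Var 0" "up s (Suc i) = lift (s i)"
  by (simp_all add: up_def)

lemma up_Var_comp: "up (\<lambda>i. Var (r i)) = (\<lambda>i. Var (up_ren r i))"
  by (rule ext) (simp add: up_def up_ren_def lift_def split: nat.split)

lemma rename_eq_subst: "rename r t = subst (\<lambda>i. Var (r i)) t"
  by (induction t arbitrary: r) (simp_all add: up_Var_comp)

lemma lift_eq_subst: "lift t = subst (\<lambda>i. Var (Suc i)) t"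
  by (simp add: lift_def rename_eq_subst)

text \<open>Under a binder \<open>up\<close> applies \<open>lift\<close>, which is a renaming. The
  composition laws therefore come in a fixed order: two renamings, the two mixed cases, two
  substitutions, each after its version for \<open>up_ren\<close> or \<open>up\<close>.\<close>

lemma up_ren_comp: "up_ren r (up_ren q i) = up_ren (\<lambda>i. r (q i)) i"
  by (cases i) simp_all

lemma rename_rename: "rename r (rename q t) = rename (\<lambda>i. r (q i)) t"
  by (induction t arbitrary: r q) (simp_all add: up_ren_comp)

lemma up_up_ren: "up s (up_ren r i) = up (\<lambda>i. s (r i)) i"
  by (cases i) simp_all

lemma subst_rename: "subst s (rename r t) = subst (\<lambda>i. s (r i)) t"
  by (induction t arbitrary: s r) (simp_all add: up_up_ren)

lemma rename_up: "rename (up_ren r) (up s i) = up (\<lambda>i. rename r (s i)) i"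
  by (cases i) (simp_all add: lift_def rename_rename)

lemma rename_subst: "rename r (subst s t) = subst (\<lambda>i. rename r (s i)) t"
  by (induction t arbitrary: s r) (simp_all add: rename_up)

lemma subst_up: "subst (up s) (up s' i) = up (\<lambda>i. subst s (s' i)) i"
  by (cases i) (simp_all add: lift_def rename_subst subst_rename)

lemma subst_subst: "subst s (subst s' t) = subst (\<lambda>i. subst s (s' i)) t"
  by (induction t arbitrary: s s') (simp_all add: subst_up)

lemma up_Var: "up Var = Var"
  by (rule ext) (simp add: up_def lift_def split: nat.split)

lemma subst_Var [simp]: "subst Var t = t"
  by (induction t) (simp_all add: up_Var)

lemma rename_lift: "rename (up_ren r) (lift t) = lift (rename r t)"
  by (simp add: lift_def rename_rename)

lemma subst0_lift [simp]: "subst0 u (lift t) = t"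
  by (simp add: subst0_def lift_eq_subst subst_subst)

section \<open>Typing and provable equality under renaming and substitution\<close>

lemma typing_rename:
  assumes "\<Gamma> \<turnstile> t \<Colon> a" and "\<And>i. i < length \<Gamma> \<Longrightarrow> r i < length \<Delta> \<and> \<Delta> ! r i = \<Gamma> ! i"
  shows "\<Delta> \<turnstile> rename r t \<Colon> a"
  using assms
proof (induction arbitrary: \<Delta> r rule: typing.induct)
  case (T_Var i \<Gamma>)
  then show ?case by (metis rename.simps(1) typing.T_Var)
next
  case (T_Lam a \<Gamma> t b)
  have "a # \<Delta> \<turnstile> rename (up_ren r) t \<Colon> b"
    by (rule T_Lam.IH) (use T_Lam.prems in \<open>auto simp: up_ren_def split: nat.split\<close>)
  then show ?case by (simp add: typing.T_Lam)
next
  case (T_Bind m \<Gamma> t a u b)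
  have "a # \<Delta> \<turnstile> rename (up_ren r) u \<Colon> m b"
    by (rule T_Bind.IH(2)) (use T_Bind.prems in \<open>auto simp: up_ren_def split: nat.split\<close>)
  moreover have "\<Delta> \<turnstile> rename r t \<Colon> m a"
    using T_Bind by blast
  ultimately show ?case using typing.T_Bind[OF T_Bind.hyps(1)] by simp
next
  case (T_App \<Gamma> t a b u)
  then show ?case by (metis rename.simps(4) typing.T_App)
qed (auto intro: typing.intros)

lemma typing_lift: "\<Gamma> \<turnstile> t \<Colon> a \<Longrightarrow> b # \<Gamma> \<turnstile> lift t \<Colon> a"
  unfolding lift_def by (rule typing_rename) auto

lemma typing_Var: "i < length \<Gamma> \<Longrightarrow> a = \<Gamma> ! i \<Longrightarrow> \<Gamma> \<turnstile> Var i \<Colon> a"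
  by (simp add: T_Var)

lemma typing_up:
  assumes "\<And>i. i < length \<Gamma> \<Longrightarrow> \<Delta> \<turnstile> s i \<Colon> \<Gamma> ! i" and "i < length (a # \<Gamma>)"
  shows "a # \<Delta> \<turnstile> up s i \<Colon> (a # \<Gamma>) ! i"
  using assms by (cases i) (auto intro: typing_lift typing_Var)

lemma typing_subst:
  assumes "\<Gamma> \<turnstile> t \<Colon> a" and "\<And>i. i < length \<Gamma> \<Longrightarrow> \<Delta> \<turnstile> s i \<Colon> \<Gamma> ! i"
  shows "\<Delta> \<turnstile> subst s t \<Colon> a"
  using assms
proof (induction arbitrary: \<Delta> s rule: typing.induct)
  case (T_Lam a \<Gamma> t b)
  then show ?case using typing_up[of \<Gamma> \<Delta> s] by (auto intro: typing.T_Lam)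
next
  case (T_Bind m \<Gamma> t a u b)
  have "a # \<Delta> \<turnstile> subst (up s) u \<Colon> m b"
    by (rule T_Bind.IH(2)) (rule typing_up[OF T_Bind.prems])
  moreover have "\<Delta> \<turnstile> subst s t \<Colon> m a"
    using T_Bind by blast
  ultimately show ?case using typing.T_Bind[OF T_Bind.hyps(1)] by simp
next
  case (T_App \<Gamma> t a b u)
  then show ?case by (metis subst.simps(4) typing.T_App)
qed (auto intro: typing.intros)

text \<open>Weakening is not a rule of its own; it is closure under the substitution that shifts
  every variable.\<close>

lemma equal_lift:
  assumes "\<Gamma> \<turnstile> t \<doteq> u \<Colon> a"
  shows "b # \<Gamma> \<turnstile> lift t \<doteq> lift u \<Colon> a"
  unfolding lift_eq_subst by (rule E_subst[OF assms]) (auto intro: typing_Var)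

lemma equal_up:
  assumes "\<And>i. i < length \<Gamma> \<Longrightarrow> \<Delta> \<turnstile> s i \<doteq> s' i \<Colon> \<Gamma> ! i" and "i < length (a # \<Gamma>)"
  shows "a # \<Delta> \<turnstile> up s i \<doteq> up s' i \<Colon> (a # \<Gamma>) ! i"
  using assms by (cases i) (auto intro!: equal_lift typing_Var E_refl)

text \<open>The rule \<open>E_subst\<close> puts one substitution into two equal terms; here two
  equal substitutions go into one term. This follows from the congruence rules along the typing
  derivation.\<close>

lemma equal_subst_cong:
  assumes "\<Gamma> \<turnstile> t \<Colon> a" and "\<And>i. i < length \<Gamma> \<Longrightarrow> \<Delta> \<turnstile> s i \<doteq> s' i \<Colon> \<Gamma> ! i"
  shows "\<Delta> \<turnstile> subst s t \<doteq> subst s' t \<Colon> a"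
  using assms
proof (induction arbitrary: \<Delta> s s' rule: typing.induct)
  case (T_Lam a \<Gamma> t b)
  have "a # \<Delta> \<turnstile> subst (up s) t \<doteq> subst (up s') t \<Colon> b"
    by (rule T_Lam.IH) (rule equal_up[OF T_Lam.prems])
  then show ?case by (simp add: E_Lam)
next
  case (T_Bind m \<Gamma> t a u b)
  have "a # \<Delta> \<turnstile> subst (up s) u \<doteq> subst (up s') u \<Colon> m b"
    by (rule T_Bind.IH(2)) (rule equal_up[OF T_Bind.prems])
  moreover have "\<Delta> \<turnstile> subst s t \<doteq> subst s' t \<Colon> m a"
    using T_Bind by blast
  ultimately show ?case using E_Bind[OF T_Bind.hyps(1)] by simp
next
  case (T_App \<Gamma> t a b u)
  then show ?case by (metis subst.simps(4) E_App)
qed (auto intro: E_Return E_refl T_Const)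

section \<open>Discarding and commuting\<close>

lemmas equal_Bind_left = E_Bind[OF _ _ E_refl]
lemmas equal_Bind_right = E_Bind[OF _ E_refl]

text \<open>Associativity, then the left unit law under the binder of \<open>s\<close>.
  Associativity shifts the free variables of \<open>u\<close> by one to make room for that binder,
  which explains the \<open>Var (Suc i)\<close>.\<close>

lemma equal_Bind_Return:
  assumes "m \<in> {Prob, Meas}" and "\<Gamma> \<turnstile> s \<Colon> m a" and "a # \<Gamma> \<turnstile> t \<Colon> b" and "b # \<Gamma> \<turnstile> u \<Colon> m c"
  shows "\<Gamma> \<turnstile> Bind (Bind s (Return t)) u \<doteq> Bind s (subst (case_nat t (\<lambda>i. Var (Suc i))) u) \<Colon> m c"
proof -
  have u: "b # a # \<Gamma> \<turnstile> rename (up_ren Suc) u \<Colon> m c"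
    by (rule typing_rename[OF assms(4)]) (auto simp: up_ren_def split: nat.split)
  have eq: "subst0 t (rename (up_ren Suc) u) = subst (case_nat t (\<lambda>i. Var (Suc i))) u"
    unfolding subst0_def subst_rename
    by (rule arg_cong[where f = "\<lambda>s. subst s u"]) (auto simp: fun_eq_iff up_ren_def split: nat.split)
  have "\<Gamma> \<turnstile> Bind (Bind s (Return t)) u \<doteq> Bind s (Bind (Return t) (rename (up_ren Suc) u)) \<Colon> m c"
    by (rule E_assoc[OF assms(1,2) T_Return[OF assms(1,3)] assms(4)])
  moreover have "\<Gamma> \<turnstile> Bind s (Bind (Return t) (rename (up_ren Suc) u))
      \<doteq> Bind s (subst (case_nat t (\<lambda>i. Var (Suc i))) u) \<Colon> m c"
    using equal_Bind_right[OF assms(1,2) E_left_unit[OF assms(1,3) u]] by (simp add: eq)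
  ultimately show ?thesis by (rule E_trans)
qed

text \<open>Both sides of \<open>E_commute\<close> and the right side of \<open>E_iid\<close> have
  this shape; the lemma hands their returned pair or stream directly to a continuation.\<close>

lemma equal_Bind_Bind_Return:
  assumes "m \<in> {Prob, Meas}" and "\<Gamma> \<turnstile> s \<Colon> m a" and "a # \<Gamma> \<turnstile> s' \<Colon> m a'"
    and "a' # a # \<Gamma> \<turnstile> t \<Colon> b" and "b # \<Gamma> \<turnstile> u \<Colon> m c"
  shows "\<Gamma> \<turnstile> Bind (Bind s (Bind s' (Return t))) u
      \<doteq> Bind s (Bind s' (subst (case_nat t (\<lambda>i. Var (Suc (Suc i)))) u)) \<Colon> m c"
proof -
  have u: "b # a # \<Gamma> \<turnstile> rename (up_ren Suc) u \<Colon> m c"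
    by (rule typing_rename[OF assms(5)]) (auto simp: up_ren_def split: nat.split)
  have eq: "subst (case_nat t (\<lambda>i. Var (Suc i))) (rename (up_ren Suc) u)
      = subst (case_nat t (\<lambda>i. Var (Suc (Suc i)))) u"
    unfolding subst_rename
    by (rule arg_cong[where f = "\<lambda>s. subst s u"]) (auto simp: fun_eq_iff up_ren_def split: nat.split)
  have "\<Gamma> \<turnstile> Bind (Bind s (Bind s' (Return t))) u
      \<doteq> Bind s (Bind (Bind s' (Return t)) (rename (up_ren Suc) u)) \<Colon> m c"
    by (rule E_assoc[OF assms(1,2) T_Bind[OF assms(1,3) T_Return[OF assms(1,4)]] assms(5)])
  moreover have "\<Gamma> \<turnstile> Bind s (Bind (Bind s' (Return t)) (rename (up_ren Suc) u))
      \<doteq> Bind s (Bind s' (subst (case_nat t (\<lambda>i. Var (Suc (Suc i)))) u)) \<Colon> m c"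
    using equal_Bind_right[OF assms(1,2) equal_Bind_Return[OF assms(1,3,4) u]] by (simp add: eq)
  ultimately show ?thesis by (rule E_trans)
qed

text \<open>The affinity axiom covers only the continuation \<open>Return unit_tm\<close>. Binding
  that unit value to a dummy variable before \<open>lift u\<close> extends it to any continuation
  that ignores the result of \<open>p\<close>.\<close>

lemma equal_Bind_discard:
  assumes "\<Gamma> \<turnstile> p \<Colon> Prob a" and "\<Gamma> \<turnstile> u \<Colon> Prob b"
  shows "\<Gamma> \<turnstile> Bind p (lift u) \<doteq> u \<Colon> Prob b"
proof -
  have m: "Prob \<in> {Prob, Meas}" by simp
  have unit: "\<Delta> \<turnstile> unit_tm \<Colon> UnitT" for \<Delta>
    by (intro T_Const const_type.intros)
  note u = typing_lift[OF assms(2), of UnitT]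
  have eq: "subst (case_nat unit_tm (\<lambda>i. Var (Suc i))) (lift u) = lift u"
    by (simp add: lift_eq_subst subst_subst)
  have "\<Gamma> \<turnstile> Bind (Bind p (Return unit_tm)) (lift u) \<doteq> Bind p (lift u) \<Colon> Prob b"
    using equal_Bind_Return[OF m assms(1) unit u] by (simp add: eq)
  moreover have "\<Gamma> \<turnstile> Bind (Bind p (Return unit_tm)) (lift u) \<doteq> u \<Colon> Prob b"
    using E_trans[OF equal_Bind_left[OF m E_affine[OF assms(1)] u] E_left_unit[OF m unit u]] by simp
  ultimately show ?thesis by (rule E_trans[OF E_sym])
qed

lemma typing_pair: "\<Gamma> \<turnstile> t \<Colon> a \<Longrightarrow> \<Gamma> \<turnstile> u \<Colon> b \<Longrightarrow> \<Gamma> \<turnstile> pair_tm t u \<Colon> ProdT a b"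
  by (intro T_App) (auto intro: T_Const const_type.intros)

lemma typing_fst: "\<Gamma> \<turnstile> t \<Colon> ProdT a b \<Longrightarrow> \<Gamma> \<turnstile> fst_tm t \<Colon> a"
  by (intro T_App) (auto intro: T_Const const_type.intros)

lemma typing_snd: "\<Gamma> \<turnstile> t \<Colon> ProdT a b \<Longrightarrow> \<Gamma> \<turnstile> snd_tm t \<Colon> b"
  by (intro T_App) (auto intro: T_Const const_type.intros)

text \<open>The axiom covers only programs that return the pair of both results. A general
  continuation is made to read its two variables from such a pair; exchanging the binders exchanges
  the indices 0 and 1.\<close>

lemma equal_Bind_commute:
  assumes m: "m \<in> {Prob, Meas}" and p: "\<Gamma> \<turnstile> p \<Colon> m a" and q: "\<Gamma> \<turnstile> q \<Colon> m b"
    and u: "b # a # \<Gamma> \<turnstile> u \<Colon> m c"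
  shows "\<Gamma> \<turnstile> Bind p (Bind (lift q) u) \<doteq> Bind q (Bind (lift p) (rename (transpose 0 1) u)) \<Colon> m c"
proof -
  \<comment> \<open>Index 0 belongs to \<open>q\<close>, the second component of the pair; index 1
    belongs to \<open>p\<close>, the first.\<close>
  define proj where
    "proj = case_nat (snd_tm (Var 0)) (case_nat (fst_tm (Var 0)) (\<lambda>i. Var (Suc i)))"
  define v where "v = subst proj u"
  have v: "ProdT a b # \<Gamma> \<turnstile> v \<Colon> m c"
    unfolding v_def proj_def
    by (rule typing_subst[OF u])
      (auto split: nat.split intro!: typing_fst[of _ _ a b] typing_snd[of _ _ a b] typing_Var)
  have xy: "b # a # \<Gamma> \<turnstile> pair_tm (Var 1) (Var 0) \<Colon> ProdT a b"
    and yx: "a # b # \<Gamma> \<turnstile> pair_tm (Var 0) (Var 1) \<Colon> ProdT a b"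
    by (auto intro!: typing_pair typing_Var)
  \<comment> \<open>Projections of the pair are only provably equal to the variables, so the two
    substitutions are compared by congruence and not syntactically.\<close>
  have "b # a # \<Gamma> \<turnstile> subst (case_nat (pair_tm (Var 1) (Var 0)) (\<lambda>i. Var (Suc (Suc i)))) v
      \<doteq> subst Var u \<Colon> m c"
    unfolding v_def subst_subst proj_def
    by (rule equal_subst_cong[OF u])
      (auto split: nat.split intro!: E_refl typing_Var E_fst[where b = b] E_snd[where a = a])
  then have 1: "b # a # \<Gamma> \<turnstile> subst (case_nat (pair_tm (Var 1) (Var 0)) (\<lambda>i. Var (Suc (Suc i)))) v
      \<doteq> u \<Colon> m c"
    by simp
  \<comment> \<open>With \<open>q\<close> bound first, the first component is \<open>Var 0\<close>
    and the second is \<open>Var 1\<close>, the opposite of what \<open>u\<close> expects.\<close>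
  have 2: "a # b # \<Gamma> \<turnstile> subst (case_nat (pair_tm (Var 0) (Var 1)) (\<lambda>i. Var (Suc (Suc i)))) v
      \<doteq> rename (transpose 0 1) u \<Colon> m c"
    unfolding v_def subst_subst rename_eq_subst proj_def
    by (rule equal_subst_cong[OF u])
      (auto split: nat.split simp: transpose_def intro!: E_refl typing_Var E_fst[where b = b] E_snd[where a = a])
  have "\<Gamma> \<turnstile> Bind (Bind p (Bind (lift q) (Return (pair_tm (Var 1) (Var 0))))) v
      \<doteq> Bind p (Bind (lift q) u) \<Colon> m c"
    by (rule E_trans[OF equal_Bind_Bind_Return[OF m p typing_lift[OF q] xy v]
          equal_Bind_right[OF m p equal_Bind_right[OF m typing_lift[OF q] 1]]])
  moreover have "\<Gamma> \<turnstile> Bind (Bind q (Bind (lift p) (Return (pair_tm (Var 0) (Var 1))))) v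
      \<doteq> Bind q (Bind (lift p) (rename (transpose 0 1) u)) \<Colon> m c"
    by (rule E_trans[OF equal_Bind_Bind_Return[OF m q typing_lift[OF p] yx v]
          equal_Bind_right[OF m q equal_Bind_right[OF m typing_lift[OF p] 2]]])
  ultimately show ?thesis
    by (rule E_trans[OF E_sym E_trans[OF equal_Bind_left[OF m E_commute[OF m p q] v]]])
qed

section \<open>Repeated draws from the same program\<close>

lemma rename_do_repeat:
  "rename r (do_repeat n p u) = do_repeat n (rename r p) (rename ((up_ren ^^ n) r) u)"
  by (induction n arbitrary: r p) (simp_all add: rename_lift funpow_swap1)

lemma up_ren_transpose: "up_ren (transpose i j) = transpose (Suc i) (Suc j)"
  by (rule ext) (simp add: up_ren_def transpose_def split: nat.split)

lemma funpow_up_ren_transpose: "(up_ren ^^ n) (transpose i j) = transpose (n + i) (n + j)"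
  by (induction n) (simp_all add: up_ren_transpose)

lemma typing_do_repeat:
  assumes "\<Gamma> \<turnstile> p \<Colon> Prob a" and "replicate n a @ \<Gamma> \<turnstile> u \<Colon> Prob b"
  shows "\<Gamma> \<turnstile> do_repeat n p u \<Colon> Prob b"
  using assms
proof (induction n arbitrary: \<Gamma> p)
  case (Suc n)
  then have "a # \<Gamma> \<turnstile> do_repeat n (lift p) u \<Colon> Prob b"
    by (simp add: replicate_app_Cons_same typing_lift)
  then show ?case
    using T_Bind[where m = Prob] Suc.prems(1) by simp
qed simp

text \<open>Neighbouring binds run the same program, so commuting them leaves the sequence of draws
  as it is and only swaps two variables in \<open>u\<close>.\<close>

lemma equal_do_repeat_transpose:
  assumes "\<Gamma> \<turnstile> p \<Colon> Prob a" and "replicate n a @ \<Gamma> \<turnstile> u \<Colon> Prob b" and "Suc k < n"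
  shows "\<Gamma> \<turnstile> do_repeat n p u \<doteq> do_repeat n p (rename (transpose k (Suc k)) u) \<Colon> Prob b"
  using assms
proof (induction n arbitrary: \<Gamma> p)
  case 0
  then show ?case by simp
next
  case (Suc n)
  have m: "Prob \<in> {Prob, Meas}" by simp
  note p' = typing_lift[OF Suc.prems(1), of a]
  have u: "replicate n a @ a # \<Gamma> \<turnstile> u \<Colon> Prob b"
    using Suc.prems(2) by (simp add: replicate_app_Cons_same)
  show ?case
  proof (cases "Suc k < n")
    case True
    then show ?thesis
      using equal_Bind_right[OF m Suc.prems(1) Suc.IH[OF p' u]] by simp
  next
    case False
    with Suc.prems(3) have n: "n = Suc k" by simp
    \<comment> \<open>The two outermost binds now bind \<open>Suc k\<close> and \<open>k\<close>,
      with \<open>k\<close> more binds below them; passing those turns the swap of 0 and 1 into the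
      swap of \<open>k\<close> and \<open>Suc k\<close>.\<close>
    have "replicate k a @ a # a # \<Gamma> \<turnstile> u \<Colon> Prob b"
      using u n by (simp add: replicate_app_Cons_same)
    then have "a # a # \<Gamma> \<turnstile> do_repeat k (lift (lift p)) u \<Colon> Prob b"
      by (intro typing_do_repeat[where a = a] typing_lift[OF p'])
    moreover have "rename (transpose 0 1) (lift (lift p)) = lift (lift p)"
      by (simp add: lift_def rename_rename transpose_def)
    ultimately show ?thesis
      using equal_Bind_commute[OF m Suc.prems(1,1)]
      by (force simp: n rename_do_repeat funpow_up_ren_transpose)
  qed
qed

section \<open>Streams\<close>

lemma typing_iid: "\<Gamma> \<turnstile> p \<Colon> Prob RealNum \<Longrightarrow> \<Gamma> \<turnstile> iid p \<Colon> Prob (Stream RealNum)"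
  by (intro T_App) (auto intro: T_Const const_type.intros)

lemma typing_tl: "\<Gamma> \<turnstile> t \<Colon> Stream a \<Longrightarrow> \<Gamma> \<turnstile> tl_tm t \<Colon> Stream a"
  by (intro T_App) (auto intro: T_Const const_type.intros)

lemma typing_cons: "\<Gamma> \<turnstile> t \<Colon> a \<Longrightarrow> \<Gamma> \<turnstile> u \<Colon> Stream a \<Longrightarrow> \<Gamma> \<turnstile> cons_tm t u \<Colon> Stream a"
  by (intro T_App) (auto intro: T_Const const_type.intros)

lemma typing_nth:
  assumes "\<Gamma> \<turnstile> t \<Colon> Stream a"
  shows "\<Gamma> \<turnstile> nth_tm t i \<Colon> a"
proof -
  have "\<Gamma> \<turnstile> (App (Const CTl) ^^ i) t \<Colon> Stream a"
    by (induction i) (simp_all add: assms typing_tl)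
  then show ?thesis
    unfolding nth_tm_def by (rule T_App[rotated]) (intro T_Const const_type.intros)
qed

lemma equal_nth:
  assumes "\<Gamma> \<turnstile> t \<doteq> u \<Colon> Stream a"
  shows "\<Gamma> \<turnstile> nth_tm t i \<doteq> nth_tm u i \<Colon> a"
proof -
  have "\<Gamma> \<turnstile> (App (Const CTl) ^^ i) t \<doteq> (App (Const CTl) ^^ i) u \<Colon> Stream a"
    by (induction i) (auto intro!: E_App E_refl T_Const const_type.intros assms)
  then show ?thesis
    unfolding nth_tm_def by (rule E_App[rotated]) (intro E_refl T_Const const_type.intros)
qed

lemma subst_nth [simp]: "subst s (nth_tm t i) = nth_tm (subst s t) i"
  unfolding nth_tm_def by (induction i) simp_all

lemma nth_tm_0: "nth_tm t 0 = hd_tm t"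
  by (simp add: nth_tm_def)

text \<open>This form puts one \<open>tl_tm\<close> directly on the stream, where
  \<open>E_tl\<close> can meet a \<open>cons_tm\<close>.\<close>

lemma nth_tm_Suc: "nth_tm t (Suc i) = nth_tm (tl_tm t) i"
  by (simp add: nth_tm_def funpow_swap1)

text \<open>After one unfolding of \<open>iid\<close>, the head is the variable 1 and the remaining
  stream the variable 0.\<close>

lemma equal_Bind_iid:
  assumes p: "\<Gamma> \<turnstile> p \<Colon> Prob RealNum" and u: "Stream RealNum # \<Gamma> \<turnstile> u \<Colon> Prob b"
  shows "\<Gamma> \<turnstile> Bind (iid p) u \<doteq> Bind p (Bind (iid (lift p))
    (subst (case_nat (cons_tm (Var 1) (Var 0)) (\<lambda>i. Var (Suc (Suc i)))) u)) \<Colon> Prob b"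
proof -
  have m: "Prob \<in> {Prob, Meas}" by simp
  have cons: "Stream RealNum # RealNum # \<Gamma> \<turnstile> cons_tm (Var 1) (Var 0) \<Colon> Stream RealNum"
    by (auto intro!: typing_cons typing_Var)
  have "lift (iid p) = iid (lift p)"
    by (simp add: lift_def)
  with E_trans[OF equal_Bind_left[OF m E_iid[OF p] u]
      equal_Bind_Bind_Return[OF m p typing_lift[OF typing_iid[OF p]] cons u]]
  show ?thesis by simp
qed

text \<open>
  \<open>read \<rho> n\<close> makes variable \<open>i < n\<close> read position \<open>\<rho> i\<close> of a stream, which is bound in place of
  the first \<open>n\<close> variables.
\<close>

definition read :: "(nat \<Rightarrow> nat) \<Rightarrow> nat \<Rightarrow> nat \<Rightarrow> tm" where
  "read \<rho> n i = (if i < n then nth_tm (Var 0) (\<rho> i) else Var (Suc (i - n)))"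

lemma typing_read:
  assumes "replicate n a @ \<Gamma> \<turnstile> u \<Colon> b"
  shows "Stream a # \<Gamma> \<turnstile> subst (read \<rho> n) u \<Colon> b"
  by (rule typing_subst[OF assms])
    (auto simp: read_def nth_append intro!: typing_nth typing_Var)

text \<open>Keeping \<open>u\<close> and \<Gamma> arbitrary is what lets the induction run: swaps
  rename \<open>u\<close>, and a variable that has received the head moves into the context.\<close>

lemma equal_iid_do_repeat:
  assumes "\<Gamma> \<turnstile> p \<Colon> Prob RealNum" and "replicate n RealNum @ \<Gamma> \<turnstile> u \<Colon> Prob b"
    and "inj_on \<rho> {..<n}" and "\<And>i. i < n \<Longrightarrow> \<rho> i < N"
  shows "\<Gamma> \<turnstile> Bind (iid p) (subst (read \<rho> n) u) \<doteq> do_repeat n p u \<Colon> Prob b"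
  using assms
proof (induction N arbitrary: \<Gamma> p n u \<rho>)
  case 0
  \<comment> \<open>No position lies below 0, so nothing is read and affinity removes the whole
    stream.\<close>
  then have n: "n = 0" by fastforce
  have "subst (read \<rho> 0) u = lift u"
    by (simp add: read_def[abs_def] lift_eq_subst)
  then show ?case
    using equal_Bind_discard[OF typing_iid] 0 n by simp
next
  case (Suc N)
  have m: "Prob \<in> {Prob, Meas}" by simp
  note p = Suc.prems(1)
  let ?unfold = "case_nat (cons_tm (Var 1) (Var 0)) (\<lambda>i. Var (Suc (Suc i)))"
  have tl: "Stream RealNum # RealNum # \<Gamma> \<turnstile> nth_tm (cons_tm (Var 1) (Var 0)) (Suc i)
      \<doteq> nth_tm (Var 0) i \<Colon> RealNum" for i \<Gamma>
    unfolding nth_tm_Suc by (intro equal_nth E_tl typing_Var) auto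
  have hd: "Stream RealNum # RealNum # \<Gamma> \<turnstile> nth_tm (cons_tm (Var 1) (Var 0)) 0 \<doteq> Var 1 \<Colon> RealNum" for \<Gamma>
    unfolding nth_tm_0 by (intro E_hd typing_Var) auto
  show ?case
  proof (cases "0 \<in> \<rho> ` {..<n}")
    case False
    define \<rho>' where "\<rho>' i = \<rho> i - 1" for i
    have \<rho>: "\<rho> i = Suc (\<rho>' i)" if "i < n" for i
      using False that unfolding \<rho>'_def by (metis Suc_pred' imageI lessThan_iff neq0_conv)
    have inj: "inj_on \<rho>' {..<n}" and bound: "\<And>i. i < n \<Longrightarrow> \<rho>' i < N"
      using Suc.prems(3,4) \<rho> by (force simp: inj_on_def)+
    note u = Suc.prems(2)
    \<comment> \<open>Every read goes past the head, so the body skips the head variable. The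
      program after the first draw is thus a \<open>lift\<close>, and that draw can be
      discarded.\<close>
    have "Stream RealNum # RealNum # \<Gamma> \<turnstile> subst ?unfold (subst (read \<rho> n) u)
        \<doteq> rename (up_ren Suc) (subst (read \<rho>' n) u) \<Colon> Prob b"
      unfolding subst_subst rename_subst
      by (rule equal_subst_cong[OF u])
        (auto simp: read_def nth_append \<rho> rename_eq_subst intro!: tl[simplified] E_refl typing_Var)
    then have "\<Gamma> \<turnstile> Bind p (Bind (iid (lift p)) (subst ?unfold (subst (read \<rho> n) u)))
        \<doteq> Bind p (lift (Bind (iid p) (subst (read \<rho>' n) u))) \<Colon> Prob b"
      using equal_Bind_right[OF m p equal_Bind_right[OF m typing_iid[OF typing_lift[OF p]]]]
      by (simp add: lift_def)
    note E_trans[OF equal_Bind_iid[OF p typing_read[OF u]] this]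
    also have "\<Gamma> \<turnstile> Bind p (lift (Bind (iid p) (subst (read \<rho>' n) u)))
        \<doteq> Bind (iid p) (subst (read \<rho>' n) u) \<Colon> Prob b"
      by (intro equal_Bind_discard[OF p] T_Bind[OF m typing_iid[OF p]] typing_read[OF u])
    also (E_trans) have "\<Gamma> \<turnstile> Bind (iid p) (subst (read \<rho>' n) u) \<doteq> do_repeat n p u \<Colon> Prob b"
      by (rule Suc.IH[OF p u inj bound])
    finally (E_trans) show ?thesis .
  next
    case True
    then obtain k where "k < n" and "\<rho> k = 0" by auto
    \<comment> \<open>Here \<open>d\<close> is the distance from \<open>k\<close> to
      \<open>n - 1\<close>, the index bound first; each adjacent swap lowers it by one.\<close>
    then obtain d where "\<rho> k = 0" and "Suc (k + d) = n"
      by (metis add_Suc less_imp_Suc_add)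
    then show ?thesis
      using Suc.prems(2-4)
    proof (induction d arbitrary: k \<rho> u)
      case 0
      then have n: "n = Suc k" by simp
      define \<rho>' where "\<rho>' i = \<rho> i - 1" for i
      have \<rho>: "\<rho> i = Suc (\<rho>' i)" if "i < k" for i
      proof -
        \<comment> \<open>By injectivity only \<open>k\<close> reads the head, so the other
          positions have predecessors.\<close>
        have "\<rho> i \<noteq> \<rho> k"
          using inj_onD[OF 0(4), of i k] that n by auto
        with 0(1) show ?thesis by (simp add: \<rho>'_def)
      qed
      have inj: "inj_on \<rho>' {..<k}"
        using 0(4) \<rho> n by (auto simp: inj_on_def less_Suc_eq)
      have bound: "\<rho>' i < N" if "i < k" for i
        using 0(5)[of i] \<rho>[OF that] that n by simp
      \<comment> \<open>The variable \<open>k\<close> is reclassified from the last of the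
        \<open>n\<close> reading variables to the first of the ambient context; \<open>u\<close>
        itself does not change.\<close>
      have u: "replicate k RealNum @ RealNum # \<Gamma> \<turnstile> u \<Colon> Prob b"
        using 0(3) by (simp add: n replicate_app_Cons_same)
      note p' = typing_lift[OF p, of RealNum]
      have "Stream RealNum # RealNum # \<Gamma> \<turnstile> subst ?unfold (subst (read \<rho> n) u)
          \<doteq> subst (read \<rho>' k) u \<Colon> Prob b"
        unfolding subst_subst
      proof (rule equal_subst_cong[OF u])
        fix i assume "i < length (replicate k RealNum @ RealNum # \<Gamma>)"
        \<comment> \<open>The cases are: a read from the tail; the head itself, which
          \<open>read \<rho>' k\<close> sends to \<open>Var 1\<close>; and an ambient variable,
          where counting one reading variable fewer makes up for the additional head binder.\<close>
        then consider "i < k" | "i = k" | "k < i" "i - Suc k < length \<Gamma>"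
          by fastforce
        then show "Stream RealNum # RealNum # \<Gamma> \<turnstile> subst ?unfold (read \<rho> n i) \<doteq> read \<rho>' k i
            \<Colon> (replicate k RealNum @ RealNum # \<Gamma>) ! i"
        proof cases
          case 1
          then show ?thesis
            using tl by (simp add: read_def n \<rho> nth_append)
        next
          case 2
          then show ?thesis
            using hd 0(1) by (simp add: read_def n nth_append)
        next
          case 3
          then obtain j where "i - k = Suc j" "i - Suc k = j"
            by (metis Suc_diff_Suc)
          with 3 show ?thesis
            by (auto simp: read_def n nth_append intro!: E_refl typing_Var)
        qed
      qed
      then have "\<Gamma> \<turnstile> Bind p (Bind (iid (lift p)) (subst ?unfold (subst (read \<rho> n) u)))
          \<doteq> Bind p (Bind (iid (lift p)) (subst (read \<rho>' k) u)) \<Colon> Prob b"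
        by (intro equal_Bind_right[OF m p] equal_Bind_right[OF m typing_iid[OF p']])
      note E_trans[OF equal_Bind_iid[OF p typing_read[OF 0(3)]] this]
      \<comment> \<open>This is the outer hypothesis for \<open>N\<close>, applied under the binder
        of the head.\<close>
      also have "\<Gamma> \<turnstile> Bind p (Bind (iid (lift p)) (subst (read \<rho>' k) u))
          \<doteq> do_repeat n p u \<Colon> Prob b"
        unfolding n do_repeat.simps
        by (rule equal_Bind_right[OF m p Suc.IH[OF p' u inj bound]])
      finally (E_trans) show ?case .
    next
      case (Suc d)
      \<comment> \<open>Swapping in \<rho> and in \<open>u\<close> together leaves the stream
        program unchanged while \<open>Suc k\<close> becomes the index that reads the head; the
        repeated draws absorb the swap by commutativity.\<close>
      let ?\<tau> = "transpose k (Suc k)"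
      have k: "Suc k < n" using Suc.prems(2) by simp
      have less: "?\<tau> i < n \<longleftrightarrow> i < n" for i
        using k by (auto simp: transpose_def)
      have u': "replicate n RealNum @ \<Gamma> \<turnstile> rename ?\<tau> u \<Colon> Prob b"
        by (rule typing_rename[OF Suc.prems(3)])
          (use k in \<open>auto simp: transpose_def nth_append\<close>)
      have "read (\<rho> \<circ> ?\<tau>) n (?\<tau> i) = read \<rho> n i" for i
      proof (cases "i < n")
        case True
        then show ?thesis by (simp add: read_def less)
      next
        case False
        with k have "?\<tau> i = i" by (intro transpose_apply_other) auto
        with False show ?thesis by (simp add: read_def)
      qed
      then have eq: "subst (read (\<rho> \<circ> ?\<tau>) n) (rename ?\<tau> u) = subst (read \<rho> n) u"
        by (simp add: subst_rename)
      have "\<Gamma> \<turnstile> Bind (iid p) (subst (read (\<rho> \<circ> ?\<tau>) n) (rename ?\<tau> u))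
          \<doteq> do_repeat n p (rename ?\<tau> u) \<Colon> Prob b"
      proof (rule Suc.IH[where k = "Suc k", OF _ _ u'])
        have "inj_on ?\<tau> {..<n}" and "?\<tau> ` {..<n} \<subseteq> {..<n}"
          using less by (auto intro: inj_on_subset[OF inj_transpose])
        then show "inj_on (\<rho> \<circ> ?\<tau>) {..<n}"
          by (meson Suc.prems(4) comp_inj_on inj_on_subset)
      qed (use Suc.prems(1,2,5) less in auto)
      from E_trans[OF this E_sym[OF equal_do_repeat_transpose[OF p Suc.prems(3) k]]]
      show ?case unfolding eq .
    qed
  qed
qed

section \<open>Tuples and the final instance\<close>

lemma subst_tuple: "subst s (tuple ts) = tuple (map (subst s) ts)"
  by (induction ts rule: tuple.induct) simp_all

lemma typing_tuple:
  assumes "\<And>t. t \<in> set ts \<Longrightarrow> \<Gamma> \<turnstile> t \<Colon> a"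
  shows "\<Gamma> \<turnstile> tuple ts \<Colon> tuple_type (replicate (length ts) a)"
  using assms
  by (induction ts rule: tuple.induct) (auto intro!: T_Const const_type.intros typing_pair)

theorem theorem2p1:
  fixes \<Gamma> :: "ty list" and p :: tm and idx :: "nat list" and n :: nat
  assumes "\<Gamma> \<turnstile> p \<Colon> Prob RealNum"
    and "length idx = n"
    and "distinct idx"
  shows "\<Gamma> \<turnstile> Bind (iid p) (Return (tuple (map (nth_tm (Var 0)) idx)))
           \<doteq> do_repeat n p (Return (tuple (map (\<lambda>k. Var (n - k)) [1..<n + 1])))
           \<Colon> Prob (tuple_type (replicate n RealNum))"
proof -
  let ?vars = "map (\<lambda>k. Var (n - k)) [1..<n + 1]"
  \<comment> \<open>De Bruijn indices count from the last bind, so index \<open>i\<close> is the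
    variable \<open>x_(n-i)\<close>; the list \<open>idx\<close> counts from 0, hence
    \<open>n - Suc i\<close>.\<close>
  define \<rho> where "\<rho> i = idx ! (n - Suc i)" for i
  have "replicate n RealNum @ \<Gamma> \<turnstile> tuple ?vars \<Colon> tuple_type (replicate (length ?vars) RealNum)"
    by (rule typing_tuple) (auto simp: nth_append intro!: typing_Var)
  then have vars: "replicate n RealNum @ \<Gamma> \<turnstile> Return (tuple ?vars)
      \<Colon> Prob (tuple_type (replicate n RealNum))"
    by (intro T_Return) (simp_all del: upt_Suc)
  have inj: "inj_on \<rho> {..<n}"
    using assms(2,3) by (auto simp: inj_on_def \<rho>_def nth_eq_iff_index_eq)
  \<comment> \<open>For an empty \<open>idx\<close> the value of \<open>Max\<close> is unspecified,
    but then no \<open>i < n\<close> exists.\<close>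
  have bound: "\<rho> i < Suc (Max (set idx))" if "i < n" for i
    using assms(2) that by (auto simp: \<rho>_def less_Suc_eq_le)
  \<comment> \<open>The two reversals cancel: \<open>Var (n - k)\<close> becomes the read of entry
    \<open>k - 1\<close> of \<open>idx\<close>.\<close>
  have "map (subst (read \<rho> n)) ?vars = map (nth_tm (Var 0)) idx"
    by (rule nth_equalityI) (use assms(2) in \<open>auto simp: read_def \<rho>_def simp del: upt_Suc\<close>)
  then show ?thesis
    using equal_iid_do_repeat[OF assms(1) vars inj bound] by (simp add: subst_tuple del: upt_Suc)
qed

end
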